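(* Let $R\in\mathbb F_{q^m}^{(k+1)\times(n-k-1)}$, let $H=\begin{pmatrix}-R^{\top}& I_{n-k-1}\end{pmatrix}$ be the parity-check matrix of the $[n,k+1]$ $\mathbb F_{q^m}$-linear code $\tilde{\mathcal C}$ generated by $\begin{pmatrix}I_{k+1}& R\end{pmatrix}$, and let $\mathbf{MaxMin}$ be the associated $m\binom{n-k-1}{r}\times\binom{n}{r}$ matrix over $\mathbb F_q$ defined in the context. Assume that there is a matrix $C=\begin{pmatrix}I_r& C'\end{pmatrix}$ with $C'\in\mathbb F_q^{r\times(n-r)}$ such that all maximal minors of $CH^{\top}$ vanish. If $\mathbf{MaxMin}$ has rank $\binom nr-1$, then the right kernel of $\mathbf{MaxMin}$ contains exactly one vector $(v_T)_{T}\in\mathbb F_q^{\binom nr}$ whose component $v_{\{1,\dots,r\}}$ equals $1$. The components of this vector are the values of the maximal minors of $C$, i.e. $v_T=c_T$ for all $T\subset\{1,\dots,n\}$ with $\#T=r$, and they give all the entries of $C$: $$C_{i,j}=(-1)^{r+i}\,v_{(\{1,\dots,r\}\setminus\{i\})\cup\{j\}}\qquad\text{for all } i\in\{1,\dots,r\},\ j\in\{r+1,\dots,n\}.$$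
   Context: Here $q$ is a prime power, $m,n,k,r$ are positive integers with $r\le n-k-1$, and $\alpha\in\mathbb F_{q^m}$ is such that $(1,\alpha,\dots,\alpha^{m-1})$ is an $\mathbb F_q$-basis of $\mathbb F_{q^m}$; for $a=\sum_{i=0}^{m-1}a_i\alpha^i$ with $a_i\in\mathbb F_q$, write $[\alpha^i](a)=a_i$. For a matrix $M$ and sets $I,J$ of row and column indices (taken in increasing order), $|M|_{I,J}$ is the determinant of the submatrix with rows in $I$ and columns in $J$; $|M|_{*,J}$ means all rows are taken. For an $r\times n$ matrix $C$ and $T\subset\{1,\dots,n\}$ with $\#T=r$, $c_T=|C|_{*,T}$. Maximal minors of the $r\times(n-k-1)$ matrix $CH^{\top}$ are its $r\times r$ minors. By the Cauchy–Binet formula, for $J\subset\{1,\dots,n-k-1\}$ with $\#J=r$ one has $|CH^{\top}|_{*,J}=\sum_{T}|H|_{J,T}\,c_T$, the sum being over $T\subset\{1,\dots,n\}$, $\#T=r$. The matrix $\mathbf{MaxMin}$ has rows indexed by the pairs $(J,i)$ with $J\subset\{1,\dots,n-k-1\}$, $\#J=r$, $0\le i\le m-1$, and columns indexed by the $T\subset\{1,\dots,n\}$ with $\#T=r$, and its entries are $$\mathbf{MaxMin}[(J,i),T]=[\alpha^i]\big(|H|_{J,T}\big).$$ Explicitly, with $T_1=T\cap\{1,\dots,k+1\}$ and $T_2=\{t-(k+1): t\in T,\ t\ge k+2\}$, one has $|H|_{J,T}=0$ if $T_2\not\subset J$, and $|H|_{J,T}=\pm|R|_{T_1,J\setminus T_2}$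 if $T_2\subset J$. (In the paper $\tilde{\mathcal C}=\mathcal C+\langle y\rangle$ arises from a decoding instance: $\mathcal C$ is an $[n,k]$ code over $\mathbb F_{q^m}$, $y=c+e$ with $c\in\mathcal C$ and $e=(1,\alpha,\dots,\alpha^{m-1})SC$, where $S\in\mathbb F_q^{m\times r}$, $C\in\mathbb F_q^{r\times n}$.) *)

theory Defs
  imports
    "Jordan_Normal_Form.Matrix_Kernel"
    "Jordan_Normal_Form.DL_Rank"
    "Jordan_Normal_Form.DL_Submatrix"
begin

text \<open>
  Matrices are those of Jordan_Normal_Form, so rows and columns are numbered from 0: the index sets
  \<open>{1,\<dots>,N}\<close> of the mathematical text become \<open>{..<N}\<close>, and every row or column index is shifted by one.

  The extension of finite fields \<open>F\<^sub>q \<subseteq> F\<^sub>q\<^sub>m\<close> is a field homomorphism \<open>\<iota> :: 'f \<Rightarrow> 'e\<close> between two finite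
  fields, where \<open>q = CARD('f)\<close>.
\<close>

definition ext_scale :: "('f::field \<Rightarrow> 'e::field) \<Rightarrow> 'f \<Rightarrow> 'e \<Rightarrow> 'e" where
  "ext_scale \<iota> c x = \<iota> c * x"

lemma vector_space_ext_scale:
  assumes "field_hom \<iota>"
  shows "vector_space (ext_scale \<iota>)"
proof -
  interpret field_hom \<iota> by fact
  show ?thesis by unfold_locales (simp_all add: ext_scale_def algebra_simps hom_distribs)
qed

text \<open>Injectivity is part of the notion, since the basis is the tuple \<open>(1, \<alpha>, \<dots>, \<alpha>\<^sup>m\<^sup>-\<^sup>1)\<close> and not just its
  set of entries.\<close>

definition is_power_basis :: "('f::field \<Rightarrow> 'e::field) \<Rightarrow> 'e \<Rightarrow> nat \<Rightarrow> bool" where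
  "is_power_basis \<iota> \<alpha> m \<longleftrightarrow>
     inj_on (\<lambda>i. \<alpha> ^ i) {..<m} \<and>
     \<not> Modules.module.dependent (ext_scale \<iota>) ((\<lambda>i. \<alpha> ^ i) ` {..<m}) \<and>
     Modules.module.span (ext_scale \<iota>) ((\<lambda>i. \<alpha> ^ i) ` {..<m}) = UNIV"

text \<open>\<open>power_coeff \<iota> \<alpha> m i a\<close> is \<open>[\<alpha>\<^sup>i](a)\<close>.\<close>

definition power_coeff :: "('f::field \<Rightarrow> 'e::field) \<Rightarrow> 'e \<Rightarrow> nat \<Rightarrow> nat \<Rightarrow> 'e \<Rightarrow> 'f" where
  "power_coeff \<iota> \<alpha> m i a =
     Modules.module.representation (ext_scale \<iota>) ((\<lambda>j. \<alpha> ^ j) ` {..<m}) a (\<alpha> ^ i)"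

lemma sum_power_coeff:
  assumes "field_hom \<iota>" "is_power_basis \<iota> \<alpha> m"
  shows "(\<Sum>i<m. \<iota> (power_coeff \<iota> \<alpha> m i a) * \<alpha> ^ i) = a"
proof -
  interpret V: vector_space "ext_scale \<iota>" by (rule vector_space_ext_scale) fact
  have B: "inj_on (\<lambda>i. \<alpha> ^ i) {..<m}" "V.independent ((\<lambda>i. \<alpha> ^ i) ` {..<m})"
    "V.span ((\<lambda>i. \<alpha> ^ i) ` {..<m}) = UNIV"
    using assms(2) unfolding is_power_basis_def by auto
  have "(\<Sum>b\<in>(\<lambda>i. \<alpha> ^ i) ` {..<m}.
      ext_scale \<iota> (V.representation ((\<lambda>i. \<alpha> ^ i) ` {..<m}) a b) b) = a"
    using B by (intro V.sum_representation_eq) auto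
  then show ?thesis
    by (simp add: sum.reindex[OF B(1)] power_coeff_def ext_scale_def)
qed

text \<open>\<open>append_cols A B\<close> is the block matrix \<open>(A B)\<close>, for matrices with the same number of rows.\<close>

definition append_cols :: "'a::zero mat \<Rightarrow> 'a mat \<Rightarrow> 'a mat" where
  "append_cols A B = four_block_mat A B (0\<^sub>m 0 (dim_col A)) (0\<^sub>m 0 (dim_col B))"

lemma append_cols_carrier [simp]:
  "A \<in> carrier_mat nr a \<Longrightarrow> B \<in> carrier_mat nr b \<Longrightarrow> append_cols A B \<in> carrier_mat nr (a + b)"
  unfolding append_cols_def by auto

lemma append_cols_index:
  assumes "A \<in> carrier_mat nr a" "B \<in> carrier_mat nr b" "i < nr" "j < a + b"
  shows "append_cols A B $$ (i, j) = (if j < a then A $$ (i, j) else B $$ (i, j - a))"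
  using assms unfolding append_cols_def by (auto simp: index_mat_four_block)

definition generator_matrix :: "'a::ring_1 mat \<Rightarrow> 'a mat" where
  "generator_matrix R = append_cols (1\<^sub>m (dim_row R)) R"

definition parity_check_matrix :: "'a::ring_1 mat \<Rightarrow> 'a mat" where
  "parity_check_matrix R = append_cols (- transpose_mat R) (1\<^sub>m (dim_col R))"

text \<open>The right kernel of the parity-check matrix is the row space of the generator matrix.\<close>

lemma mat_kernel_parity_check_matrix:
  fixes R :: "'a::field mat"
  shows "mat_kernel (parity_check_matrix R) =
     {transpose_mat (generator_matrix R) *\<^sub>v u | u. u \<in> carrier_vec (dim_row R)}"
proof -
  define a b where "a = dim_row R" and "b = dim_col R"
  have R: "R \<in> carrier_mat a b" unfolding a_def b_def by auto
  have ker: "x \<in> mat_kernel (parity_check_matrix R) \<longleftrightarrow>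
      (\<exists>u\<in>carrier_vec a. x = u @\<^sub>v (transpose_mat R *\<^sub>v u))" for x
  proof -
    have mult: "parity_check_matrix R *\<^sub>v (u @\<^sub>v w) = - (transpose_mat R *\<^sub>v u) + w"
      if "u \<in> carrier_vec a" "w \<in> carrier_vec b" for u w
    proof -
      have "parity_check_matrix R *\<^sub>v (u @\<^sub>v w) =
          ((- transpose_mat R) *\<^sub>v u + 1\<^sub>m b *\<^sub>v w) @\<^sub>v (0\<^sub>m 0 a *\<^sub>v u + 0\<^sub>m 0 b *\<^sub>v w)"
        unfolding parity_check_matrix_def append_cols_def using R that
        by (subst four_block_mat_mult_vec[of _ b a _ b _ 0]) auto
      also have "\<dots> = - (transpose_mat R *\<^sub>v u) + w"
        using R that by (intro eq_vecI) (auto simp: append_vec_def)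
      finally show ?thesis .
    qed
    have H: "parity_check_matrix R \<in> carrier_mat b (a + b)"
      unfolding parity_check_matrix_def using R by auto
    show ?thesis
    proof
      assume x: "x \<in> mat_kernel (parity_check_matrix R)"
      then have "x \<in> carrier_vec (a + b)" "parity_check_matrix R *\<^sub>v x = 0\<^sub>v b"
        using mat_kernelD[OF H] by auto
      then obtain u w where uw: "x = u @\<^sub>v w" "u \<in> carrier_vec a" "w \<in> carrier_vec b"
        by (metis vec_first_last_append vec_first_carrier vec_last_carrier)
      have z: "- (transpose_mat R *\<^sub>v u) + w = 0\<^sub>v b"
        using mult[OF uw(2,3)] uw(1) \<open>parity_check_matrix R *\<^sub>v x = 0\<^sub>v b\<close> by simp
      have "w = transpose_mat R *\<^sub>v u"
      proof (rule eq_vecI)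
        fix i assume "i < dim_vec (transpose_mat R *\<^sub>v u)"
        then have "i < b" using R by simp
        then have "(- (transpose_mat R *\<^sub>v u) + w) $ i = 0" using z by simp
        then show "w $ i = (transpose_mat R *\<^sub>v u) $ i" using \<open>i < b\<close> R uw(3) by simp
      qed (use R uw in auto)
      then show "\<exists>u\<in>carrier_vec a. x = u @\<^sub>v (transpose_mat R *\<^sub>v u)" using uw by blast
    next
      assume "\<exists>u\<in>carrier_vec a. x = u @\<^sub>v (transpose_mat R *\<^sub>v u)"
      then obtain u where u: "u \<in> carrier_vec a" "x = u @\<^sub>v (transpose_mat R *\<^sub>v u)" by blast
      have w: "transpose_mat R *\<^sub>v u \<in> carrier_vec b" using R u by auto
      have "parity_check_matrix R *\<^sub>v x = 0\<^sub>v b"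
        unfolding u(2) mult[OF u(1) w] using w by (intro eq_vecI) auto
      then show "x \<in> mat_kernel (parity_check_matrix R)"
        using u w by (intro mat_kernelI[OF H]) auto
    qed
  qed
  have gen: "transpose_mat (generator_matrix R) *\<^sub>v u = u @\<^sub>v (transpose_mat R *\<^sub>v u)"
    if u: "u \<in> carrier_vec a" for u
  proof (rule eq_vecI)
    have G: "generator_matrix R \<in> carrier_mat a (a + b)"
      unfolding generator_matrix_def using R by auto
    show "dim_vec (transpose_mat (generator_matrix R) *\<^sub>v u) = dim_vec (u @\<^sub>v (transpose_mat R *\<^sub>v u))"
      using G R u by auto
    fix i assume "i < dim_vec (u @\<^sub>v (transpose_mat R *\<^sub>v u))"
    then have i: "i < a + b" using R u by auto
    have "col (generator_matrix R) i = (if i < a then unit_vec a i else col R (i - a))"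
    proof (rule eq_vecI)
      fix l assume "l < dim_vec (if i < a then unit_vec a i else col R (i - a))"
      then have l: "l < a" using R by (auto split: if_splits)
      have "generator_matrix R $$ (l, i) = (if i < a then 1\<^sub>m a $$ (l, i) else R $$ (l, i - a))"
        using append_cols_index[OF one_carrier_mat R l i] R unfolding generator_matrix_def by simp
      then show "col (generator_matrix R) i $ l = (if i < a then unit_vec a i else col R (i - a)) $ l"
        using l i R G by auto
    qed (use R G in auto)
    then show "(transpose_mat (generator_matrix R) *\<^sub>v u) $ i = (u @\<^sub>v (transpose_mat R *\<^sub>v u)) $ i"
      using i R G u by auto
  qed
  show ?thesis
  proof (rule Set.set_eqI)
    fix x
    have "x \<in> mat_kernel (parity_check_matrix R) \<longleftrightarrow>
        (\<exists>u\<in>carrier_vec a. x = transpose_mat (generator_matrix R) *\<^sub>v u)"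
      unfolding ker by (rule bex_cong) (simp_all only: gen)
    then show "x \<in> mat_kernel (parity_check_matrix R) \<longleftrightarrow>
        x \<in> {transpose_mat (generator_matrix R) *\<^sub>v u | u. u \<in> carrier_vec (dim_row R)}"
      unfolding a_def[symmetric] by blast
  qed
qed

text \<open>All \<open>r\<close>-subsets of \<open>{..<N}\<close>, in an order that only serves to number rows and columns.\<close>

definition rsubsets :: "nat \<Rightarrow> nat \<Rightarrow> nat set list" where
  "rsubsets N r = filter (\<lambda>T. card T = r) (map set (subseqs [0..<N]))"

lemma set_rsubsets: "set (rsubsets N r) = {T. T \<subseteq> {..<N} \<and> card T = r}"
proof -
  have "set (map set (subseqs [0..<N])) = Pow {..<N}"
    using subseqs_powset[of "[0..<N]"] by (simp add: atLeast0LessThan)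
  then show ?thesis unfolding rsubsets_def set_filter by blast
qed

lemma distinct_rsubsets: "distinct (rsubsets N r)"
  unfolding rsubsets_def by (simp add: distinct_set_subseqs)

lemma length_rsubsets: "length (rsubsets N r) = N choose r"
  using distinct_card[OF distinct_rsubsets[of N r]] n_subsets[of "{..<N}" r]
  by (simp add: set_rsubsets)

text \<open>\<open>subset_entry N r v T\<close> is the component \<open>v\<^sub>T\<close> of a vector \<open>v\<close> whose coordinates are numbered by the
  \<open>r\<close>-subsets of \<open>{..<N}\<close>.\<close>

definition subset_entry :: "nat \<Rightarrow> nat \<Rightarrow> 'a vec \<Rightarrow> nat set \<Rightarrow> 'a" where
  "subset_entry N r v T = v $ (THE l. l < length (rsubsets N r) \<and> rsubsets N r ! l = T)"

lemma subset_entry_nth: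
  "l < length (rsubsets N r) \<Longrightarrow> subset_entry N r v (rsubsets N r ! l) = v $ l"
  unfolding subset_entry_def
  by (rule arg_cong[where f = "\<lambda>l. v $ l"], rule the_equality)
     (auto simp: nth_eq_iff_index_eq[OF distinct_rsubsets])

definition minor :: "'a::comm_ring_1 mat \<Rightarrow> nat set \<Rightarrow> nat set \<Rightarrow> 'a" where
  "minor M I J = det (submatrix M I J)"

text \<open>The row with number \<open>p = l * m + i\<close>, where \<open>i < m\<close>, is the one of the pair \<open>(J, i)\<close> with \<open>J\<close> the \<open>l\<close>-th
  \<open>r\<close>-subset of the row indices of \<open>H\<close>.\<close>

definition MaxMin :: "('f::field \<Rightarrow> 'e::field) \<Rightarrow> 'e \<Rightarrow> nat \<Rightarrow> nat \<Rightarrow> 'e mat \<Rightarrow> 'f mat" where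
  "MaxMin \<iota> \<alpha> m r H =
     mat (length (rsubsets (dim_row H) r) * m) (length (rsubsets (dim_col H) r))
       (\<lambda>(p, t). power_coeff \<iota> \<alpha> m (p mod m)
          (minor H (rsubsets (dim_row H) r ! (p div m)) (rsubsets (dim_col H) r ! t)))"

lemma MaxMin_carrier:
  "MaxMin \<iota> \<alpha> m r H \<in> carrier_mat (m * (dim_row H choose r)) (dim_col H choose r)"
  by (simp add: MaxMin_def length_rsubsets mult.commute)

end

theory Submission
  imports Defs
begin

text \<open>By the Cauchy--Binet formula, the vector of maximal minors of \<open>C\<close> lies in the kernel of the
  matrix of coefficients, and its component at the first \<open>r\<close> columns is the minor of the identity block.
  If two different kernel vectors had the same nonzero component there, then two columns of the matrix
  would lie in the span of the others, so the corank would be at least two. Exchanging one column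
  of the identity block for a column of \<open>C'\<close> gives a minor that is an entry of \<open>C'\<close> up to sign.\<close>

section \<open>The Cauchy--Binet formula\<close>

text \<open>Turns a sum over the positions in a submatrix into a sum over the selected indices
  themselves.\<close>

lemma bij_betw_pick:
  assumes "finite T"
  shows "bij_betw (pick T) {..<card T} T"
proof -
  have "inj_on (pick T) {..<card T}"
    by (rule linorder_inj_onI') (metis lessThan_iff nat_neq_iff pick_mono)
  moreover have "pick T ` {..<card T} \<subseteq> T"
    by (auto intro: pick_in_set)
  ultimately show ?thesis
    by (metis assms bij_betw_def card_image card_lessThan card_subset_eq)
qed

lemma submatrix_carrier_columns:
  assumes "A \<in> carrier_mat nr nc" "T \<subseteq> {..<nc}"
  shows "submatrix A UNIV T \<in> carrier_mat nr (card T)"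
proof -
  have "{j. j < nc \<and> j \<in> T} = T" using assms(2) by auto
  then show ?thesis using assms(1) by (auto simp: submatrix_def)
qed

lemma submatrix_carrier_rows:
  assumes "A \<in> carrier_mat nr nc" "T \<subseteq> {..<nr}"
  shows "submatrix A T UNIV \<in> carrier_mat (card T) nc"
proof -
  have "{j. j < nr \<and> j \<in> T} = T" using assms(2) by auto
  then show ?thesis using assms(1) by (auto simp: submatrix_def)
qed

lemma submatrix_columns_index:
  assumes "A \<in> carrier_mat nr nc" "T \<subseteq> {..<nc}" "i < nr" "j < card T"
  shows "submatrix A UNIV T $$ (i, j) = A $$ (i, pick T j)"
proof -
  have "{j. j < nc \<and> j \<in> T} = T" using assms(2) by auto
  then show ?thesis using assms by (simp add: submatrix_def pick_UNIV)
qed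

lemma submatrix_rows_index:
  assumes "A \<in> carrier_mat nr nc" "T \<subseteq> {..<nr}" "i < card T" "j < nc"
  shows "submatrix A T UNIV $$ (i, j) = A $$ (pick T i, j)"
proof -
  have "{j. j < nr \<and> j \<in> T} = T" using assms(2) by auto
  then show ?thesis using assms by (simp add: submatrix_def pick_UNIV)
qed

text \<open>Column selection only touches the right factor. A maximal minor of a product thus
  becomes the determinant of a product to which the Cauchy-Binet formula applies.\<close>

lemma submatrix_mult_columns:
  assumes "A \<in> carrier_mat r n" "B \<in> carrier_mat n s" "J \<subseteq> {..<s}"
  shows "submatrix (A * B) UNIV J = A * submatrix B UNIV J"
proof (rule eq_matI)
  have S: "submatrix B UNIV J \<in> carrier_mat n (card J)"
    "submatrix (A * B) UNIV J \<in> carrier_mat r (card J)"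
    using assms by (auto intro!: submatrix_carrier_columns)
  show "dim_row (submatrix (A * B) UNIV J) = dim_row (A * submatrix B UNIV J)"
    "dim_col (submatrix (A * B) UNIV J) = dim_col (A * submatrix B UNIV J)"
    using S assms by auto
  fix i j assume "i < dim_row (A * submatrix B UNIV J)" "j < dim_col (A * submatrix B UNIV J)"
  then have ij: "i < r" "j < card J" using S assms by auto
  have "pick J j \<in> J" using ij by (intro pick_in_set) auto
  then have pj: "pick J j < s" using assms(3) by auto
  have "submatrix (A * B) UNIV J $$ (i, j) = (A * B) $$ (i, pick J j)"
    using assms ij by (intro submatrix_columns_index) auto
  also have "\<dots> = (\<Sum>l = 0..<n. A $$ (i, l) * B $$ (l, pick J j))"
    using assms ij pj by (simp add: scalar_prod_def)
  also have "\<dots> = (\<Sum>l = 0..<n. A $$ (i, l) * submatrix B UNIV J $$ (l, j))"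
    using submatrix_columns_index[OF assms(2,3)] ij by simp
  also have "\<dots> = (A * submatrix B UNIV J) $$ (i, j)"
    using assms ij S by (simp add: scalar_prod_def)
  finally show "submatrix (A * B) UNIV J $$ (i, j) = (A * submatrix B UNIV J) $$ (i, j)" .
qed

lemma submatrix_transpose:
  "submatrix (transpose_mat A) I J = transpose_mat (submatrix A J I)"
proof (rule eq_matI)
  fix i j assume "i < dim_row (transpose_mat (submatrix A J I))"
    "j < dim_col (transpose_mat (submatrix A J I))"
  then have ij: "i < card {i. i < dim_col A \<and> i \<in> I}" "j < card {j. j < dim_row A \<and> j \<in> J}"
    by (auto simp: dim_submatrix)
  have "pick I i < dim_col A" "pick J j < dim_row A" using ij by (auto intro: pick_le)
  then show "submatrix (transpose_mat A) I J $$ (i, j) = transpose_mat (submatrix A J I) $$ (i, j)"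
    using ij by (simp add: submatrix_def)
qed (simp_all add: dim_submatrix)

lemma minor_transpose:
  assumes "A \<in> carrier_mat nr nc" "I \<subseteq> {..<nr}" "J \<subseteq> {..<nc}" "card I = card J"
  shows "minor (transpose_mat A) J I = minor A I J"
proof -
  have "{i. i < nr \<and> i \<in> I} = I" "{j. j < nc \<and> j \<in> J} = J" using assms(2,3) by auto
  then have "submatrix A I J \<in> carrier_mat (card I) (card I)"
    using assms by (auto simp: submatrix_def)
  then show ?thesis
    unfolding minor_def submatrix_transpose by (rule det_transpose)
qed

lemma minor_map_mat:
  assumes "comm_ring_hom h"
  shows "minor (map_mat h A) I J = h (minor A I J)"
proof -
  interpret comm_ring_hom h by fact
  have "submatrix (map_mat h A) I J = map_mat h (submatrix A I J)"
    by (rule eq_matI) (simp_all add: submatrix_def pick_le)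
  then show ?thesis unfolding minor_def by simp
qed

text \<open>Row \<open>i\<close> is the sum over \<open>k\<close> in \<open>S\<close> of
  \<open>A $$ (i, k)\<close> times row \<open>k\<close> of \<open>B\<close>, so multilinearity
  yields one term per choice of a \<open>k\<close> for each row. A choice is a map fixed as the
  identity off \<open>{0..<r}\<close>, so that distinct maps are distinct choices.\<close>

lemma det_partial_product:
  fixes A B :: "'a::comm_ring_1 mat"
  assumes B: "B \<in> carrier_mat n r" and S: "S \<subseteq> {..<n}"
  shows "det (mat r r (\<lambda>(i, j). \<Sum>k\<in>S. A $$ (i, k) * B $$ (k, j))) =
    (\<Sum>f\<in>{f. (\<forall>i\<in>{0..<r}. f i \<in> S) \<and> (\<forall>i. i \<notin> {0..<r} \<longrightarrow> f i = i)}.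
       det (mat\<^sub>r r r (\<lambda>i. A $$ (i, f i) \<cdot>\<^sub>v row B (f i))))"
proof -
  have fS: "finite S" using S finite_subset by blast
  have c: "(\<lambda>k. A $$ (i, k) \<cdot>\<^sub>v row B k) \<in> S \<rightarrow> carrier_vec r" for i using B by auto
  have "mat r r (\<lambda>(i, j). \<Sum>k\<in>S. A $$ (i, k) * B $$ (k, j)) =
      mat\<^sub>r r r (\<lambda>i. finsum_vec TYPE('a) r (\<lambda>k. A $$ (i, k) \<cdot>\<^sub>v row B k) S)"
    using B S by (intro eq_matI) (auto simp: index_finsum_vec[OF fS _ c] intro!: sum.cong)
  then show ?thesis
    using det_linear_rows_sum[OF fS, of "\<lambda>i k. A $$ (i, k) \<cdot>\<^sub>v row B k" r] c by auto
qed

text \<open>Multilinearity in the rows expands both sides over maps from row indices to \<open>{..<n}\<close>; on the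
  right, \<open>T\<close> contributes the maps into \<open>T\<close>. Only injective maps survive, and each of these takes
  its values in exactly one \<open>T\<close> with \<open>r\<close> elements, namely its range.\<close>

theorem Cauchy_Binet:
  fixes A B :: "'a::comm_ring_1 mat"
  assumes A: "A \<in> carrier_mat r n" and B: "B \<in> carrier_mat n r"
  shows "det (A * B) = (\<Sum>T\<in>{T. T \<subseteq> {..<n} \<and> card T = r}. minor A UNIV T * minor B T UNIV)"
proof -
  define F where "F S = {f. (\<forall>i\<in>{0..<r}. f i \<in> S) \<and> (\<forall>i. i \<notin> {0..<r} \<longrightarrow> f i = i)}"
    for S :: "nat set"
  define I where "I S = {f \<in> F S. inj_on f {0..<r}}" for S
  define D where "D f = det (mat\<^sub>r r r (\<lambda>i. A $$ (i, f i) \<cdot>\<^sub>v row B (f i)))" for f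
  define \<T> where "\<T> = {T. T \<subseteq> {..<n} \<and> card T = r}"
  have finF: "finite (F S)" if "S \<subseteq> {..<n}" for S
    unfolding F_def using that by (intro finite_bounded_functions) (auto intro: finite_subset)
  \<comment> \<open>Once the scalars are taken out of the rows, two rows of the remaining matrix are
    the same row of \<open>B\<close>.\<close>
  have D0: "D f = 0" if f: "f \<in> F {..<n}" "\<not> inj_on f {0..<r}" for f
  proof -
    let ?M = "mat\<^sub>r r r (\<lambda>i. row B (f i))"
    obtain i j where ij: "i \<noteq> j" "i < r" "j < r" "f i = f j"
      using f(2) unfolding inj_on_def by auto
    have "row ?M i = row ?M j" using ij B by (intro eq_vecI) auto
    then have "det ?M = 0"
      using ij by (intro det_identical_rows[of _ r i j]) (auto intro: mat_row_carrierI)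
    then show ?thesis
      unfolding D_def using B by (subst det_rows_mul) auto
  qed
  have restrict: "sum D (F S) = sum D (I S)" if S: "S \<subseteq> {..<n}" for S
  proof -
    have "F S \<subseteq> F {..<n}" using S unfolding F_def by auto
    then show ?thesis
      using D0 by (intro sum.mono_neutral_right finF[OF S]) (auto simp: I_def)
  qed
  have minors: "minor A UNIV T * minor B T UNIV = sum D (I T)" if T: "T \<in> \<T>" for T
  proof -
    have T': "T \<subseteq> {..<n}" "card T = r" "finite T"
      using T finite_subset unfolding \<T>_def by blast+
    have SA: "submatrix A UNIV T \<in> carrier_mat r r"
      using submatrix_carrier_columns[OF A T'(1)] T' by simp
    have SB: "submatrix B T UNIV \<in> carrier_mat r r"
      using submatrix_carrier_rows[OF B T'(1)] T' by simp
    \<comment> \<open>The product of the two submatrices is the partial product for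
      \<open>S = T\<close>, just as \<open>A * B\<close> is the one for \<open>S = {..<n}\<close>;
      this is why the expansion was stated for arbitrary \<open>S\<close>.\<close>
    have prod: "submatrix A UNIV T * submatrix B T UNIV =
        mat r r (\<lambda>(i, j). \<Sum>k\<in>T. A $$ (i, k) * B $$ (k, j))"
    proof (rule eq_matI)
      fix i j assume "i < dim_row (mat r r (\<lambda>(i, j). \<Sum>k\<in>T. A $$ (i, k) * B $$ (k, j)))"
        "j < dim_col (mat r r (\<lambda>(i, j). \<Sum>k\<in>T. A $$ (i, k) * B $$ (k, j)))"
      then have ij: "i < r" "j < r" by auto
      have "(submatrix A UNIV T * submatrix B T UNIV) $$ (i, j) =
          (\<Sum>l\<in>{..<r}. submatrix A UNIV T $$ (i, l) * submatrix B T UNIV $$ (l, j))"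
        using SA SB ij by (simp add: scalar_prod_def lessThan_atLeast0)
      also have "\<dots> = (\<Sum>l\<in>{..<card T}. A $$ (i, pick T l) * B $$ (pick T l, j))"
        using submatrix_columns_index[OF A T'(1)] submatrix_rows_index[OF B T'(1)] ij T' by simp
      also have "\<dots> = (\<Sum>k\<in>T. A $$ (i, k) * B $$ (k, j))"
        by (rule sum.reindex_bij_betw[OF bij_betw_pick[OF T'(3)]])
      finally show "(submatrix A UNIV T * submatrix B T UNIV) $$ (i, j) =
          mat r r (\<lambda>(i, j). \<Sum>k\<in>T. A $$ (i, k) * B $$ (k, j)) $$ (i, j)"
        using ij by simp
    qed (use SA SB in auto)
    show ?thesis
      unfolding minor_def det_mult[OF SA SB, symmetric] prod det_partial_product[OF B T'(1)]
      using restrict[OF T'(1)] by (simp add: F_def D_def)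
  qed
  have "A * B = mat r r (\<lambda>(i, j). \<Sum>k\<in>{..<n}. A $$ (i, k) * B $$ (k, j))"
    using A B by (intro eq_matI) (auto simp: scalar_prod_def lessThan_atLeast0)
  then have "det (A * B) = sum D (I {..<n})"
    using det_partial_product[OF B, of "{..<n}" A] restrict[of "{..<n}"] by (simp add: F_def D_def)
  also have "I {..<n} = (\<Union>T\<in>\<T>. I T)"
  proof
    show "I {..<n} \<subseteq> (\<Union>T\<in>\<T>. I T)"
    proof
      fix f assume "f \<in> I {..<n}"
      then have "f ` {0..<r} \<in> \<T>" "f \<in> I (f ` {0..<r})"
        by (auto simp: I_def F_def \<T>_def card_image)
      then show "f \<in> (\<Union>T\<in>\<T>. I T)" by blast
    qed
  qed (auto simp: I_def F_def \<T>_def)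
  also have "sum D (\<Union>T\<in>\<T>. I T) = (\<Sum>T\<in>\<T>. sum D (I T))"
  proof (rule sum.UNION_disjoint)
    show "finite \<T>" unfolding \<T>_def by auto
    show "\<forall>T\<in>\<T>. finite (I T)" using finF unfolding I_def \<T>_def by auto
    have "f ` {0..<r} = T" if "T \<in> \<T>" "f \<in> I T" for f T
    proof (rule card_subset_eq)
      show "finite T" using that(1) finite_subset unfolding \<T>_def by blast
    qed (use that in \<open>auto simp: I_def F_def \<T>_def card_image\<close>)
    then show "\<forall>S\<in>\<T>. \<forall>T\<in>\<T>. S \<noteq> T \<longrightarrow> I S \<inter> I T = {}" by blast
  qed
  also have "\<dots> = (\<Sum>T\<in>\<T>. minor A UNIV T * minor B T UNIV)"
    using minors by simp
  finally show ?thesis unfolding \<T>_def .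
qed

section \<open>Kernels of matrices of corank one\<close>

text \<open>The relation \<open>A *\<^sub>v x = 0\<^sub>v n\<close> is solved for column
  \<open>t\<close>. Columns with coefficient zero drop out, hence the disjunction in the last
  hypothesis.\<close>

lemma (in vec_space) col_in_span:
  assumes A: "A \<in> carrier_mat n nc" and x: "x \<in> carrier_vec nc" "A *\<^sub>v x = 0\<^sub>v n"
    and t: "t < nc" "x $ t \<noteq> 0" and W: "W \<subseteq> carrier_vec n"
    and s: "\<And>s. s < nc \<Longrightarrow> s \<noteq> t \<Longrightarrow> x $ s = 0 \<or> col A s \<in> span W"
  shows "col A t \<in> span W"
proof -
  \<comment> \<open>The value 0 at \<open>t\<close> allows the combination to run over all
    columns.\<close>
  define c where "c s = (if s = t then 0 else - x $ s / x $ t)" for s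
  have carr: "col A s \<in> carrier_vec n" for s using A by auto
  have zero: "0\<^sub>v n \<in> span W" using W sumlist_in_span[of W "[]"] by simp
  \<comment> \<open>A column with coefficient 0 may lie outside the span, but its multiple is the
    zero vector.\<close>
  have mem: "c s \<cdot>\<^sub>v col A s \<in> span W" if "s < nc" for s
  proof (cases "c s = 0")
    case True
    then show ?thesis using zero carr[of s] by simp
  next
    case False
    then have "col A s \<in> span W" using s[OF that] by (auto simp: c_def split: if_splits)
    then show ?thesis by (rule smult_in_span[OF W])
  qed
  have "col A t = sumlist (map (\<lambda>s. c s \<cdot>\<^sub>v col A s) [0..<nc])"
  proof (rule eq_vecI)
    have d: "dim_vec (sumlist (map (\<lambda>s. c s \<cdot>\<^sub>v col A s) [0..<nc])) = n"
      using A by (intro dim_sumlist) auto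
    then show "dim_vec (col A t) = dim_vec (sumlist (map (\<lambda>s. c s \<cdot>\<^sub>v col A s) [0..<nc]))"
      using A by simp
    fix i assume "i < dim_vec (sumlist (map (\<lambda>s. c s \<cdot>\<^sub>v col A s) [0..<nc]))"
    then have i: "i < n" using d by simp
    have "(\<Sum>s = 0..<nc. A $$ (i, s) * x $ s) = (A *\<^sub>v x) $ i"
      using A x(1) i by (simp add: scalar_prod_def)
    also have "\<dots> = 0" using x(2) i by simp
    finally have "0 = (\<Sum>s = 0..<nc. A $$ (i, s) * x $ s)" by simp
    also have "\<dots> = A $$ (i, t) * x $ t + (\<Sum>s\<in>{0..<nc} - {t}. A $$ (i, s) * x $ s)"
      using t(1) by (intro sum.remove) auto
    finally have "A $$ (i, t) * x $ t = - (\<Sum>s\<in>{0..<nc} - {t}. A $$ (i, s) * x $ s)"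
      by (simp add: eq_neg_iff_add_eq_0)
    then have "A $$ (i, t) = - (\<Sum>s\<in>{0..<nc} - {t}. A $$ (i, s) * x $ s) / x $ t"
      using t(2) by (simp add: field_simps)
    also have "\<dots> = (\<Sum>s\<in>{0..<nc} - {t}. c s * A $$ (i, s))"
      by (simp add: sum_negf[symmetric] sum_divide_distrib c_def mult.commute)
    also have "\<dots> = (\<Sum>s = 0..<nc. c s * A $$ (i, s))"
      by (rule sum.mono_neutral_left) (auto simp: c_def)
    also have "\<dots> = sumlist (map (\<lambda>s. c s \<cdot>\<^sub>v col A s) [0..<nc]) $ i"
      using A i by (subst sumlist_nth) auto
    finally show "col A t $ i = sumlist (map (\<lambda>s. c s \<cdot>\<^sub>v col A s) [0..<nc]) $ i"
      using A i t(1) by simp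
  qed
  also have "\<dots> \<in> span W" proof (rule sumlist_in_span[OF W])
    fix y assume "y \<in> set (map (\<lambda>s. c s \<cdot>\<^sub>v col A s) [0..<nc])"
    then obtain s where s: "s < nc" "y = c s \<cdot>\<^sub>v col A s" by auto
    show "y \<in> span W" unfolding s(2) by (rule mem[OF s(1)])
  qed
  finally show ?thesis .
qed

text \<open>\<open>S\<close> spans the column space, so a maximal independent subset of
  \<open>S\<close> already has as many elements as the rank.\<close>

lemma (in vec_space) rank_le_card_spanning:
  assumes A: "A \<in> carrier_mat n nc" and S: "S \<subseteq> set (cols A)" "set (cols A) \<subseteq> span S"
  shows "rank A \<le> card S"
proof -
  have carr: "set (cols A) \<subseteq> carrier_vec n" using cols_dim A by blast
  have fin: "finite S" using S(1) finite_subset by blast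
  have Sc: "S \<subseteq> carrier_vec n" using S(1) carr by blast
  have "S \<subseteq> span (set (cols A))" using S(1) carr in_own_span by blast
  then have span: "span (set (cols A)) = span S"
    using span_subsetI[OF Sc S(2)] span_subsetI[OF carr] by blast
  have ind: "{} \<subseteq> S \<and> lin_indpt {}" by (auto simp: lin_dep_def)
  obtain U where U: "maximal U (\<lambda>T. T \<subseteq> S \<and> lin_indpt T)"
    using maximal_exists_superset[OF fin, of "\<lambda>T. T \<subseteq> S \<and> lin_indpt T" "{}"] ind by auto
  have "rank A = card U"
    unfolding rank_def span using dim_span[OF _ fin U] Sc by simp
  also have "\<dots> \<le> card S" using U fin by (intro card_mono) (auto simp: maximal_def)
  finally show ?thesis .
qed

lemma (in vec_space) kernel_eq_if_corank_le_1:
  assumes A: "A \<in> carrier_mat n nc" and rank: "nc \<le> rank A + 1"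
    and v: "v \<in> mat_kernel A" and w: "w \<in> mat_kernel A"
    and s: "s < nc" "v $ s = w $ s" "v $ s \<noteq> 0"
  shows "v = w"
proof (rule ccontr)
  assume "v \<noteq> w"
  note vD = mat_kernelD[OF A v] and wD = mat_kernelD[OF A w]
  obtain t where t: "t < nc" "v $ t \<noteq> w $ t"
    using \<open>v \<noteq> w\<close> vD(1) wD(1) by (metis carrier_vecD eq_vecI)
  then have ts: "t \<noteq> s" using s(2) by auto
  define u where "u = v - w"
  have u: "u \<in> carrier_vec nc" "A *\<^sub>v u = 0\<^sub>v n" "u $ s = 0" "u $ t \<noteq> 0"
    using vD wD s t A by (auto simp: u_def mult_minus_distrib_mat_vec)
  \<comment> \<open>Equal columns collapse in this set, which only lowers its cardinality, so
    \<open>nc - 2\<close> remains an upper bound.\<close>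
  define S where "S = col A ` ({..<nc} - {s, t})"
  have S: "S \<subseteq> set (cols A)" using A by (auto simp: S_def cols_def)
  have Sc: "S \<subseteq> carrier_vec n" using A by (auto simp: S_def)
  have other: "col A l \<in> span S" if "l < nc" "l \<noteq> s" "l \<noteq> t" for l
    using that Sc by (intro in_own_span[THEN subsetD]) (auto simp: S_def)
  have t_span: "col A t \<in> span S"
    using u other t by (intro col_in_span[OF A u(1,2) t(1) u(4) Sc]) auto
  \<comment> \<open>With column \<open>t\<close> available, \<open>v\<close> can be used to express
    column \<open>s\<close>, because \<open>v $ s\<close> is nonzero.\<close>
  have s_span: "col A s \<in> span S"
    using other t_span by (intro col_in_span[OF A vD s(1,3) Sc]) auto
  have "set (cols A) \<subseteq> span S"
    using A other t_span s_span by (force simp: cols_def)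
  then have "rank A \<le> card S" by (rule rank_le_card_spanning[OF A S])
  also have "\<dots> \<le> card ({..<nc} - {s, t})" unfolding S_def by (rule card_image_le) simp
  also have "\<dots> = nc - 2" using s(1) t(1) ts by (subst card_Diff_subset) auto
  finally show False using rank s(1) t(1) ts by linarith
qed

section \<open>The kernel of the matrix of coefficients of minors\<close>

lemma sum_rsubsets_nth:
  "(\<Sum>t = 0..<length (rsubsets N r). g (rsubsets N r ! t)) =
   (\<Sum>T\<in>{T. T \<subseteq> {..<N} \<and> card T = r}. g T)"
  unfolding set_rsubsets[symmetric] atLeast0LessThan
  by (rule sum.reindex_bij_betw[OF bij_betw_nth[OF distinct_rsubsets refl refl]])

text \<open>Taking a coefficient in the power basis is linear over the small field, and the scalars
  \<open>c x\<close> come from there.\<close>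

lemma power_coeff_sum:
  assumes "field_hom \<iota>" "is_power_basis \<iota> \<alpha> m"
  shows "power_coeff \<iota> \<alpha> m i (\<Sum>x\<in>X. \<iota> (c x) * a x) = (\<Sum>x\<in>X. c x * power_coeff \<iota> \<alpha> m i (a x))"
proof -
  interpret V: vector_space "ext_scale \<iota>" by (rule vector_space_ext_scale) fact
  have B: "V.independent ((\<lambda>i. \<alpha> ^ i) ` {..<m})" "V.span ((\<lambda>i. \<alpha> ^ i) ` {..<m}) = UNIV"
    using assms(2) unfolding is_power_basis_def by auto
  have "power_coeff \<iota> \<alpha> m i (\<Sum>x\<in>X. ext_scale \<iota> (c x) (a x)) =
      (\<Sum>x\<in>X. c x * power_coeff \<iota> \<alpha> m i (a x))"
    unfolding power_coeff_def using B
    by (simp add: V.representation_sum V.representation_scale)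
  then show ?thesis unfolding ext_scale_def .
qed

text \<open>The coordinates follow the numbering that \<open>MaxMin\<close> uses for its
  columns.\<close>

definition maximal_minors :: "nat \<Rightarrow> nat \<Rightarrow> 'a::comm_ring_1 mat \<Rightarrow> 'a vec" where
  "maximal_minors n r C = vec (n choose r) (\<lambda>t. minor C UNIV (rsubsets n r ! t))"

lemma subset_entry_maximal_minors:
  assumes "T \<subseteq> {..<n}" "card T = r"
  shows "subset_entry n r (maximal_minors n r C) T = minor C UNIV T"
proof -
  have "T \<in> set (rsubsets n r)" using assms by (simp add: set_rsubsets)
  then obtain l where "l < length (rsubsets n r)" "rsubsets n r ! l = T"
    by (metis in_set_conv_nth)
  then show ?thesis
    using subset_entry_nth[of l n r "maximal_minors n r C"]
    by (simp add: maximal_minors_def length_rsubsets)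
qed

text \<open>By Cauchy-Binet, each vanishing minor is a combination of minors of \<open>H\<close>
  whose coefficients, the minors of \<open>C\<close>, lie in the small field. The coefficient of
  \<alpha>^i of this relation is row \<open>(J, i)\<close> of the linear system.\<close>

lemma maximal_minors_in_kernel:
  assumes \<iota>: "field_hom \<iota>" and basis: "is_power_basis \<iota> \<alpha> m"
    and H: "H \<in> carrier_mat p n" and C: "C \<in> carrier_mat r n"
    and vanish: "\<And>J. J \<subseteq> {..<p} \<Longrightarrow> card J = r \<Longrightarrow>
      minor (map_mat \<iota> C * transpose_mat H) UNIV J = 0"
  shows "maximal_minors n r C \<in> mat_kernel (MaxMin \<iota> \<alpha> m r H)"
proof (rule mat_kernelI[OF MaxMin_carrier])
  interpret \<iota>: field_hom \<iota> by fact
  let ?M = "MaxMin \<iota> \<alpha> m r H"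
  have dims [simp]: "dim_row H = p" "dim_col H = n" using H by auto
  show "maximal_minors n r C \<in> carrier_vec (dim_col H choose r)"
    by (simp add: maximal_minors_def)
  show "?M *\<^sub>v maximal_minors n r C = 0\<^sub>v (m * (dim_row H choose r))"
  proof (rule eq_vecI)
    fix q assume "q < dim_vec (0\<^sub>v (m * (dim_row H choose r)) :: 'a vec)"
    then have q: "q < length (rsubsets p r) * m"
      by (simp add: length_rsubsets mult.commute)
    \<comment> \<open>Decodes the row number \<open>q\<close> into its pair
      \<open>(J, i)\<close>.\<close>
    define J where "J = rsubsets p r ! (q div m)"
    define i where "i = q mod m"
    have "J \<in> set (rsubsets p r)"
      unfolding J_def using q by (intro nth_mem less_mult_imp_div_less)
    then have J: "J \<subseteq> {..<p}" "card J = r" by (simp_all add: set_rsubsets)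
    \<comment> \<open>Selecting columns \<open>J\<close> and then rows \<open>T\<close> of the
      transpose gives the transposed submatrix of \<open>H\<close>; it is square, so the determinant
      is unchanged.\<close>
    have JT: "minor (submatrix (transpose_mat H) UNIV J) T UNIV = minor H J T"
      if "T \<subseteq> {..<n}" "card T = r" for T
      using minor_transpose[OF H J(1) that(1)] J(2) that(2)
        submatrix_split[of "transpose_mat H" T J]
      by (simp add: minor_def)
    have HJ: "submatrix (transpose_mat H) UNIV J \<in> carrier_mat n r"
      using submatrix_carrier_columns[of "transpose_mat H" n p J] H J by simp
    have "0 = det (map_mat \<iota> C * submatrix (transpose_mat H) UNIV J)"
      using vanish[OF J] submatrix_mult_columns[of "map_mat \<iota> C" r n "transpose_mat H" p J] C H J
      by (simp add: minor_def)
    also have "\<dots> = (\<Sum>T\<in>{T. T \<subseteq> {..<n} \<and> card T = r}.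
        minor (map_mat \<iota> C) UNIV T * minor (submatrix (transpose_mat H) UNIV J) T UNIV)"
      using C HJ by (intro Cauchy_Binet) auto
    also have "\<dots> = (\<Sum>T\<in>{T. T \<subseteq> {..<n} \<and> card T = r}. \<iota> (minor C UNIV T) * minor H J T)"
      using JT by (intro sum.cong) (auto simp: minor_map_mat[OF \<iota>.comm_ring_hom_axioms])
    finally have zero: "(\<Sum>T\<in>{T. T \<subseteq> {..<n} \<and> card T = r}. \<iota> (minor C UNIV T) * minor H J T) = 0"
      by simp
    have "(?M *\<^sub>v maximal_minors n r C) $ q = (\<Sum>t = 0..<length (rsubsets n r).
        minor C UNIV (rsubsets n r ! t) * power_coeff \<iota> \<alpha> m i (minor H J (rsubsets n r ! t)))"
      using q by (simp add: MaxMin_def maximal_minors_def scalar_prod_def J_def i_def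
          length_rsubsets mult.commute)
    also have "\<dots> = (\<Sum>T\<in>{T. T \<subseteq> {..<n} \<and> card T = r}.
        minor C UNIV T * power_coeff \<iota> \<alpha> m i (minor H J T))"
      by (rule sum_rsubsets_nth)
    \<comment> \<open>The 0 is read as the Cauchy-Binet sum, to which linearity applies.\<close>
    also have "\<dots> = power_coeff \<iota> \<alpha> m i 0"
      unfolding zero[symmetric] power_coeff_sum[OF \<iota> basis] ..
    \<comment> \<open>Linearity for the empty sum gives the coefficient of zero.\<close>
    also have "\<dots> = 0" using power_coeff_sum[OF \<iota> basis, of i _ _ "{}"] by simp
    finally show "(?M *\<^sub>v maximal_minors n r C) $ q =
        0\<^sub>v (m * (dim_row H choose r)) $ q"
      using q by (simp add: length_rsubsets mult.commute)
  qed (simp add: MaxMin_def length_rsubsets mult.commute)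
qed

section \<open>Minors of a matrix in systematic form\<close>

text \<open>The increasing enumeration of an initial segment is the identity, so the selected
  columns are exactly the identity block.\<close>

lemma minor_systematic:
  fixes C' :: "'a::comm_ring_1 mat"
  assumes C': "C' \<in> carrier_mat r s"
  shows "minor (append_cols (1\<^sub>m r) C') UNIV {..<r} = 1"
proof -
  let ?C = "append_cols (1\<^sub>m r) C'"
  have C: "?C \<in> carrier_mat r (r + s)" using C' by simp
  have pick: "pick {..<r} l = l" if "l < r" for l
  proof -
    have "{a \<in> {..<r}. a < l} = {..<l}" using that by auto
    then show ?thesis using pick_card_in_set[of l "{..<r}"] that by simp
  qed
  have S: "submatrix ?C UNIV {..<r} \<in> carrier_mat r r"
    using submatrix_carrier_columns[OF C, of "{..<r}"] by simp
  have "submatrix ?C UNIV {..<r} = 1\<^sub>m r"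
    by (rule eq_matI)
      (use S pick in \<open>auto simp: submatrix_columns_index[OF C] append_cols_index[OF one_carrier_mat C']\<close>)
  then show ?thesis by (simp add: minor_def)
qed

text \<open>In the \<open>i\<close>-th row of the submatrix only the entry from column \<open>j\<close>, which comes last, is nonzero,
  and its cofactor is that of an identity matrix.\<close>

lemma minor_systematic_exchange:
  fixes C' :: "'a::comm_ring_1 mat"
  assumes C': "C' \<in> carrier_mat r s" and i: "i < r" and j: "r \<le> j" "j < r + s"
  shows "minor (append_cols (1\<^sub>m r) C') UNIV ({..<r} - {i} \<union> {j}) =
    (-1) ^ (r + Suc i) * append_cols (1\<^sub>m r) C' $$ (i, j)"
proof -
  define C where "C = append_cols (1\<^sub>m r) C'"
  define T where "T = {..<r} - {i} \<union> {j}"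
  define D where "D = submatrix C UNIV T"
  have C: "C \<in> carrier_mat r (r + s)" using C' by (simp add: C_def)
  have T: "T \<subseteq> {..<r + s}" "card T = r" using i j by (auto simp: T_def)
  have D: "D \<in> carrier_mat r r"
    using submatrix_carrier_columns[OF C T(1)] T(2) by (simp add: D_def)
  \<comment> \<open>Positions are found by counting the smaller elements of \<open>T\<close>: the
    gap at \<open>i\<close> shifts every later column of the identity block by one.\<close>
  have pick_below: "pick T l = (if l < i then l else Suc l)" if l: "l < r - 1" for l
  proof (cases "l < i")
    case True
    then have "{a \<in> T. a < l} = {..<l}" using i j by (auto simp: T_def)
    then show ?thesis using pick_card_in_set[of l T] True i by (simp add: T_def)
  next
    case False
    then have "{a \<in> T. a < Suc l} = {..<Suc l} - {i}" using l i j by (auto simp: T_def)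
    then have "card {a \<in> T. a < Suc l} = l" using False by simp
    moreover have "Suc l \<in> T" using l False by (auto simp: T_def)
    ultimately show ?thesis using pick_card_in_set[of "Suc l" T] False by simp
  qed
  have "{a \<in> T. a < j} = {..<r} - {i}" using i j by (auto simp: T_def)
  then have pick_last: "pick T (r - 1) = j"
    using pick_card_in_set[of j T] i by (simp add: T_def)
  have Dl: "D $$ (a, l) = (if a = (if l < i then l else Suc l) then 1 else 0)"
    if "a < r" "l < r - 1" for a l
  proof -
    have "D $$ (a, l) = C $$ (a, pick T l)"
      using that T(2) unfolding D_def by (intro submatrix_columns_index[OF C T(1)]) auto
    then show ?thesis
      using that i pick_below[of l] append_cols_index[OF one_carrier_mat C'] by (auto simp: C_def)
  qed
  \<comment> \<open>Deleting row \<open>i\<close> shifts the rows in the same way as the gap in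
    \<open>T\<close> shifts the columns, so the ones return to the diagonal.\<close>
  have "mat_delete D i (r - 1) = 1\<^sub>m (r - 1)"
    by (rule eq_matI) (use D i in \<open>auto simp: mat_delete_def Dl\<close>)
  then have cof: "cofactor D i (r - 1) = (-1) ^ (i + (r - 1))" by (simp add: cofactor_def)
  have "det D = (\<Sum>l<r. D $$ (i, l) * cofactor D i l)"
    by (rule laplace_expansion_row[OF D i])
  also have "\<dots> = (\<Sum>l\<in>{r - 1}. D $$ (i, l) * cofactor D i l)"
  proof (rule sum.mono_neutral_right)
    show "\<forall>l\<in>{..<r} - {r - 1}. D $$ (i, l) * cofactor D i l = 0"
    proof
      fix l assume "l \<in> {..<r} - {r - 1}"
      then have "l < r - 1" by auto
      then show "D $$ (i, l) * cofactor D i l = 0" using Dl[OF i] by auto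
    qed
  qed (use i in auto)
  also have "\<dots> = (-1) ^ (i + (r - 1)) * C $$ (i, j)"
  proof -
    have "D $$ (i, r - 1) = C $$ (i, pick T (r - 1))"
      using i T(2) unfolding D_def by (intro submatrix_columns_index[OF C T(1)]) auto
    then show ?thesis unfolding pick_last using cof by simp
  qed
  \<comment> \<open>The exponents differ by 2. \<open>Suc i\<close> is the row number counted from
    1.\<close>
  also have "(-1) ^ (i + (r - 1)) = ((-1) ^ (r + Suc i) :: 'a)"
    using i by (cases r) (simp_all add: add.commute)
  finally show ?thesis by (simp add: minor_def C_def D_def T_def)
qed

theorem proposition4:
  fixes \<iota> :: "'f::{field,finite} \<Rightarrow> 'e::{field,finite}"
    and \<alpha> :: 'e
    and m n k r :: nat
    and R H :: "'e mat"
    and C' C :: "'f mat"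
  assumes "field_hom \<iota>"
    and "m > 0" and "n > 0" and "k > 0" and "r > 0"
    and "r \<le> n - k - 1"
    and "is_power_basis \<iota> \<alpha> m"
    and "R \<in> carrier_mat (k + 1) (n - k - 1)"
    and "H = parity_check_matrix R"
    and "C' \<in> carrier_mat r (n - r)"
    and "C = append_cols (1\<^sub>m r) C'"
    and "\<forall>J. J \<subseteq> {..<n - k - 1} \<and> card J = r \<longrightarrow>
           minor (map_mat \<iota> C * transpose_mat H) UNIV J = 0"
    and "vec_space.rank (m * ((n - k - 1) choose r)) (MaxMin \<iota> \<alpha> m r H) = (n choose r) - 1"
  shows "(\<exists>!v. v \<in> mat_kernel (MaxMin \<iota> \<alpha> m r H) \<and> subset_entry n r v {..<r} = 1) \<and>
    (\<forall>v. v \<in> mat_kernel (MaxMin \<iota> \<alpha> m r H) \<and> subset_entry n r v {..<r} = 1 \<longrightarrow>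
      (\<forall>T. T \<subseteq> {..<n} \<and> card T = r \<longrightarrow> subset_entry n r v T = minor C UNIV T) \<and>
      (\<forall>i\<in>{..<r}. \<forall>j\<in>{r..<n}.
         C $$ (i, j) = (-1) ^ (r + Suc i) * subset_entry n r v (({..<r} - {i}) \<union> {j})))"
proof -
  let ?M = "MaxMin \<iota> \<alpha> m r H"
  define c where "c = maximal_minors n r C"
  \<comment> \<open>As \<open>r\<close> is positive, the bound on \<open>r\<close> forces
    \<open>k + 1 < n\<close>, so the truncated subtraction is a true difference.\<close>
  have n: "r < n" "k + 1 + (n - k - 1) = n" using assms(5,6) by auto
  have H: "H \<in> carrier_mat (n - k - 1) n"
    using append_cols_carrier[of "- transpose_mat R" "n - k - 1" "k + 1" "1\<^sub>m (n - k - 1)" "n - k - 1"]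
      assms(8,9) n(2)
    by (simp add: parity_check_matrix_def)
  have C: "C \<in> carrier_mat r n"
    using append_cols_carrier[OF one_carrier_mat assms(10)] assms(11) n(1) by simp
  have M: "?M \<in> carrier_mat (m * ((n - k - 1) choose r)) (n choose r)"
    using MaxMin_carrier[of \<iota> \<alpha> m r H] H by simp
  have c_ker: "c \<in> mat_kernel ?M"
    unfolding c_def using maximal_minors_in_kernel[OF assms(1,7) H C] assms(12) by blast
  have c_entry: "subset_entry n r c T = minor C UNIV T" if "T \<subseteq> {..<n}" "card T = r" for T
    unfolding c_def by (rule subset_entry_maximal_minors[OF that])
  have c_1: "subset_entry n r c {..<r} = 1"
    using c_entry[of "{..<r}"] minor_systematic[OF assms(10)] assms(11) n(1) by simp
  have "{..<r} \<in> set (rsubsets n r)" using n(1) by (simp add: set_rsubsets)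
  \<comment> \<open>The uniqueness lemma compares vectors at a numbered coordinate; \<open>l\<close>
    is the number of the set \<open>{..<r}\<close>.\<close>
  then obtain l where l: "l < length (rsubsets n r)" "rsubsets n r ! l = {..<r}"
    by (metis in_set_conv_nth)
  have l_entry: "v $ l = subset_entry n r v {..<r}" for v :: "'f vec"
    using subset_entry_nth[OF l(1), of v] l(2) by simp
  have uniq: "v = c" if "v \<in> mat_kernel ?M \<and> subset_entry n r v {..<r} = 1" for v
  proof (rule vec_space.kernel_eq_if_corank_le_1[OF M])
    show "n choose r \<le> vec_space.rank (m * ((n - k - 1) choose r)) ?M + 1"
      using assms(13) by simp
    show "l < n choose r" using l(1) by (simp add: length_rsubsets)
  qed (use that c_ker c_1 l_entry in auto)
  \<comment> \<open>The exchange lemma expresses the minor by the entry; as the sign squares to 1,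
    multiplying by it again recovers the entry.\<close>
  have c_exchange: "C $$ (i, j) = (-1) ^ (r + Suc i) * subset_entry n r c (({..<r} - {i}) \<union> {j})"
    if "i < r" "r \<le> j" "j < n" for i j
  proof -
    have "minor C UNIV ({..<r} - {i} \<union> {j}) = (-1) ^ (r + Suc i) * C $$ (i, j)"
      using minor_systematic_exchange[OF assms(10) that(1,2)] that(3) n(1) assms(11) by simp
    moreover have "subset_entry n r c ({..<r} - {i} \<union> {j}) = minor C UNIV ({..<r} - {i} \<union> {j})"
      using that by (intro c_entry) auto
    ultimately show ?thesis
      by (simp add: mult.assoc[symmetric] power_add[symmetric] mult_2[symmetric] del: power_Suc)
  qed
  show ?thesis
  proof (intro conjI)
    show "\<exists>!v. v \<in> mat_kernel ?M \<and> subset_entry n r v {..<r} = 1"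
      using c_ker c_1 uniq by blast
  \<comment> \<open>Any normalized kernel vector equals \<open>c\<close>, so the claims about all
    such vectors reduce to those shown for \<open>c\<close>.\<close>
  qed (use uniq c_entry c_exchange in \<open>auto simp del: power_Suc\<close>)
qed

end
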